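(* Let the data and the problems (P) and (R) be as defined in the context, and assume that the step $h$ satisfies $$(1-h\gamma)\,\bar w-hg(1+c)>\left(\frac{P_{\max}h}{2M(\lambda\gamma P_{\max}h+1)}\right)^{2/3}.$$ Assume moreover that the maximum squared speed profile satisfies, for all $i\in\{1,\dots,n\}$, $$\frac{P_{\max}}{M\sqrt{w^{\max}_i}}\ \ge\ \gamma w^{\max}_i+g(\sin\alpha_i+c).$$ Then, for every optimal solution $(w^*,t^*,f^* )$ of the relaxed problem (R), the pair $(w,F)=(w^*,Mf^* )$ is feasible for (P) and, thus, is an optimal solution of (P).
   Context: Data: an integer $n\ge 2$; positive constants $h,M,g,\mu,c,\Gamma,P_{\max}$; constants $\lambda\ge 0$ and $\eta\in[0,1]$; angles $\alpha_1,\dots,\alpha_n\in\mathbb{R}$; bounds $w^{\max}_1,\dots,w^{\max}_n>0$; $w_{\mathrm{init}}\ge 0$. Put $\gamma:=\Gamma/M$, and let $\bar w>0$ (the critical squared speed) be the solution of $\frac{P_{\max}}{M\sqrt{\bar w}}=g\mu$. Problem (P) (non-convex), in variables $w\in\mathbb{R}^n$, $F\in\mathbb{R}^{n-1}$: minimize $$\sum_{i=1}^{n-1}h\Big(\lambda\max\{\eta F_i,F_i\}+\frac1{\sqrt{w_i}}\Big)$$ subject to: $0\le w_i\le w^{\max}_i$ for $i\in\{1,\dots,n\}$; $w_1=w_{\mathrm{init}}$; and, for $i\in\{1,\dots,n-1\}$: $|F_i|\le Mg\mu$, $F_i\sqrt{w_i}\le P_{\max}$, and $\frac Mh(w_{i+1}-w_i)=-\Gamma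 w_i+F_i-Mg\sin\alpha_i-Mgc$. Problem (R) (convex relaxation), in variables $w\in\mathbb{R}^n$, $t,f\in\mathbb{R}^{n-1}$: minimize $$\sum_{i=1}^{n-1}h\big(\lambda M\max\{\eta f_i,f_i\}+t_i\big)$$ subject to: $0\le w_i\le w^{\max}_i$ for $i\in\{1,\dots,n\}$; $w_1=w_{\mathrm{init}}$; and, for $i\in\{1,\dots,n-1\}$: $|f_i|\le g\mu$, $t_i\ge \frac1{\sqrt{w_i}}$, $t_i\ge\frac{Mf_i}{P_{\max}}$, and $f_i=\frac1h(w_{i+1}-w_i)+\gamma w_i+g(\sin\alpha_i+c)$. Convention: expressions $1/\sqrt{w_i}$ in (P) and (R) require $w_i>0$ for $i\in\{1,\dots,n-1\}$. *)

theory Defs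
  imports Complex_Main
begin

text \<open>
  A vector with components \<open>1, \<dots>, n\<close> (resp. \<open>1, \<dots>, n - 1\<close>) is represented by a function
  \<open>nat \<Rightarrow> real\<close>, of which only the values on \<open>{1..n}\<close> (resp. \<open>{1..<n}\<close>) are ever inspected.

  Since \<open>1 / sqrt 0 = 0\<close> in HOL, the positivity of \<open>w i\<close> that is implicit in the expressions
  \<open>1 / sqrt (w i)\<close>, \<open>i < n\<close>, is imposed as an explicit constraint in both problems.
\<close>

definition objective_P ::
  "nat \<Rightarrow> real \<Rightarrow> real \<Rightarrow> real \<Rightarrow> (nat \<Rightarrow> real) \<Rightarrow> (nat \<Rightarrow> real) \<Rightarrow> real" where
  "objective_P n h lam \<eta> w F =
     (\<Sum>i\<in>{1..<n}. h * (lam * max (\<eta> * F i) (F i) + 1 / sqrt (w i)))"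

definition feasible_P ::
  "nat \<Rightarrow> real \<Rightarrow> real \<Rightarrow> real \<Rightarrow> real \<Rightarrow> real \<Rightarrow> real \<Rightarrow> real \<Rightarrow> (nat \<Rightarrow> real) \<Rightarrow> (nat \<Rightarrow> real) \<Rightarrow> real \<Rightarrow>
   (nat \<Rightarrow> real) \<Rightarrow> (nat \<Rightarrow> real) \<Rightarrow> bool" where
  "feasible_P n h M g \<mu> c \<Gamma> Pmax \<alpha> wmax winit w F \<longleftrightarrow>
     (\<forall>i\<in>{1..n}. 0 \<le> w i \<and> w i \<le> wmax i) \<and>
     w 1 = winit \<and>
     (\<forall>i\<in>{1..<n}.
        0 < w i \<and>
        \<bar>F i\<bar> \<le> M * g * \<mu> \<and>
        F i * sqrt (w i) \<le> Pmax \<and>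
        M / h * (w (i + 1) - w i) = - \<Gamma> * w i + F i - M * g * sin (\<alpha> i) - M * g * c)"

definition optimal_P ::
  "nat \<Rightarrow> real \<Rightarrow> real \<Rightarrow> real \<Rightarrow> real \<Rightarrow> real \<Rightarrow> real \<Rightarrow> real \<Rightarrow> real \<Rightarrow> real \<Rightarrow>
   (nat \<Rightarrow> real) \<Rightarrow> (nat \<Rightarrow> real) \<Rightarrow> real \<Rightarrow> (nat \<Rightarrow> real) \<Rightarrow> (nat \<Rightarrow> real) \<Rightarrow> bool" where
  "optimal_P n h M g \<mu> c \<Gamma> Pmax lam \<eta> \<alpha> wmax winit w F \<longleftrightarrow>
     is_arg_min (\<lambda>(w, F). objective_P n h lam \<eta> w F)
       (\<lambda>(w, F). feasible_P n h M g \<mu> c \<Gamma> Pmax \<alpha> wmax winit w F) (w, F)"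

definition objective_R ::
  "nat \<Rightarrow> real \<Rightarrow> real \<Rightarrow> real \<Rightarrow> real \<Rightarrow> (nat \<Rightarrow> real) \<Rightarrow> (nat \<Rightarrow> real) \<Rightarrow> real" where
  "objective_R n h M lam \<eta> t f =
     (\<Sum>i\<in>{1..<n}. h * (lam * M * max (\<eta> * f i) (f i) + t i))"

definition feasible_R ::
  "nat \<Rightarrow> real \<Rightarrow> real \<Rightarrow> real \<Rightarrow> real \<Rightarrow> real \<Rightarrow> real \<Rightarrow> real \<Rightarrow> (nat \<Rightarrow> real) \<Rightarrow> (nat \<Rightarrow> real) \<Rightarrow> real \<Rightarrow>
   (nat \<Rightarrow> real) \<Rightarrow> (nat \<Rightarrow> real) \<Rightarrow> (nat \<Rightarrow> real) \<Rightarrow> bool" where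
  "feasible_R n h M g \<mu> c \<gamma> Pmax \<alpha> wmax winit w t f \<longleftrightarrow>
     (\<forall>i\<in>{1..n}. 0 \<le> w i \<and> w i \<le> wmax i) \<and>
     w 1 = winit \<and>
     (\<forall>i\<in>{1..<n}.
        0 < w i \<and>
        \<bar>f i\<bar> \<le> g * \<mu> \<and>
        t i \<ge> 1 / sqrt (w i) \<and>
        t i \<ge> M * f i / Pmax \<and>
        f i = 1 / h * (w (i + 1) - w i) + \<gamma> * w i + g * (sin (\<alpha> i) + c))"

definition optimal_R ::
  "nat \<Rightarrow> real \<Rightarrow> real \<Rightarrow> real \<Rightarrow> real \<Rightarrow> real \<Rightarrow> real \<Rightarrow> real \<Rightarrow> real \<Rightarrow> real \<Rightarrow>
   (nat \<Rightarrow> real) \<Rightarrow> (nat \<Rightarrow> real) \<Rightarrow> real \<Rightarrow>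
   (nat \<Rightarrow> real) \<Rightarrow> (nat \<Rightarrow> real) \<Rightarrow> (nat \<Rightarrow> real) \<Rightarrow> bool" where
  "optimal_R n h M g \<mu> c \<gamma> Pmax lam \<eta> \<alpha> wmax winit w t f \<longleftrightarrow>
     is_arg_min (\<lambda>(w, t, f). objective_R n h M lam \<eta> t f)
       (\<lambda>(w, t, f). feasible_R n h M g \<mu> c \<gamma> Pmax \<alpha> wmax winit w t f) (w, t, f)"

end

theory Submission
  imports Defs
begin

text \<open>
  Suppose \<open>M f\<^sub>i \<surd>w\<^sub>i > Pmax\<close> for some \<open>i\<close> and take the last such \<open>i\<close>.  Then \<open>w\<^sub>i > wbar\<close>, and the
  hypothesis on the maximum speed profile gives \<open>w\<^sub>i\<^sub>+\<^sub>1 > w\<^sub>i\<close>; as \<open>i + 1\<close> respects the power bound,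
  \<open>f\<^sub>i\<^sub>+\<^sub>1 < g \<mu>\<close>.  Hence \<open>w\<^sub>i\<^sub>+\<^sub>1\<close> can be lowered by a small \<open>\<delta>\<close>.  This lowers \<open>f\<^sub>i\<close> by \<open>\<delta> / h\<close>, raises
  \<open>f\<^sub>i\<^sub>+\<^sub>1\<close> by only \<open>\<delta> (1 / h - \<gamma>)\<close>, allows \<open>t\<^sub>i\<close> to drop by \<open>\<delta> M / (h Pmax)\<close>, and requires raising
  \<open>t\<^sub>i\<^sub>+\<^sub>1\<close> by at most \<open>\<delta> max (1 / (2 wbar \<surd>wbar)) (M (1 / h - \<gamma>) / Pmax)\<close>.  By the step size condition
  that maximum is below \<open>M / (h Pmax) + lam M \<gamma>\<close>, so the objective decreases, against optimality.
\<close>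

section \<open>Elementary inequalities\<close>

lemma inverse_sqrt_diff_le:
  fixes a u v :: real
  assumes "0 < a" "a \<le> v" "v \<le> u"
  shows "1 / sqrt v - 1 / sqrt u \<le> (u - v) / (2 * (a * sqrt a))"
proof -
  define p q r where "p = sqrt v" and "q = sqrt u" and "r = sqrt a"
  have r: "0 < r" "r \<le> p" "p \<le> q"
    using assms by (auto simp: p_def q_def r_def)
  have "u - v = (q - p) * (q + p)" "a = r * r"
    using assms by (auto simp: p_def q_def r_def algebra_simps)
  \<comment> \<open>An algebraic mean value bound: the slope of \<open>1 / sqrt x\<close> is at most
    \<open>1 / (2 * (a * sqrt a))\<close> in absolute value for \<open>x \<ge> a\<close>, and
    \<open>p * q * (p + q)\<close> stands in for the intermediate point.\<close>
  have "r * r * (r + r) \<le> p * q * (p + q)"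
    using r by (intro mult_mono) auto
  then have "2 * (r * r * r) \<le> p * q * (p + q)"
    by (simp add: algebra_simps)
  then have "(q - p) * (q + p) / (p * q * (p + q)) \<le> (q - p) * (q + p) / (2 * (r * r * r))"
    using r by (intro divide_left_mono mult_nonneg_nonneg mult_pos_pos) auto
  moreover have "1 / p - 1 / q = (q - p) * (q + p) / (p * q * (p + q))"
    using r by (simp add: divide_simps)
  ultimately show ?thesis
    unfolding p_def[symmetric] q_def[symmetric] r_def[symmetric] \<open>u - v = (q - p) * (q + p)\<close>
    by (simp only: \<open>a = r * r\<close>)
qed

text \<open>Raising to the power 3/2 is strictly monotone and turns \<open>a\<close> into
  \<open>a * sqrt a\<close>. This rids the step size condition of its exponent 2/3 and brings it to
  the form of the slope of \<open>1 / sqrt\<close>.\<close>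

lemma less_mult_sqrt_if_powr_less:
  fixes K a :: real
  assumes "0 \<le> K" "0 < a" "K powr (2 / 3) < a"
  shows "K < a * sqrt a"
proof -
  have "K = (K powr (2 / 3)) powr (3 / 2)"
    using assms(1) by (simp add: powr_powr)
  also have "\<dots> < a powr (3 / 2)"
    using assms by (intro powr_less_mono2) auto
  also have "\<dots> = a powr (1 + 1 / 2)"
    by simp
  also have "\<dots> = a * sqrt a"
    using assms(2) by (subst powr_add) (simp add: powr_half_sqrt)
  finally show ?thesis .
qed

text \<open>Both branches of the maximum have slope at most 1, whatever the signs of
  \<open>x\<close> and \<open>y\<close>.\<close>

lemma max_scaled_diff_le:
  fixes \<eta> x y :: real
  assumes "\<eta> \<le> 1" "x \<le> y"
  shows "max (\<eta> * y) y - max (\<eta> * x) x \<le> y - x"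
proof -
  have "\<eta> * (y - x) \<le> 1 * (y - x)"
    using assms by (intro mult_right_mono) auto
  then show ?thesis
    by (auto simp: max_def algebra_simps)
qed

lemma max_scaled_pos:
  fixes \<eta> x :: real
  assumes "\<eta> \<le> 1" "0 \<le> x"
  shows "max (\<eta> * x) x = x"
  using mult_right_mono[OF assms] by simp

section \<open>Transfer between (P) and (R)\<close>

lemma feasible_R_of_P:
  assumes "M > 0" "Pmax > 0" "\<gamma> = \<Gamma> / M"
    and "feasible_P n h M g \<mu> c \<Gamma> Pmax \<alpha> wmax winit w F"
  shows "feasible_R n h M g \<mu> c \<gamma> Pmax \<alpha> wmax winit w (\<lambda>i. 1 / sqrt (w i)) (\<lambda>i. F i / M)"
proof -
  have "\<bar>F i / M\<bar> \<le> g * \<mu> \<and> M * (F i / M) / Pmax \<le> 1 / sqrt (w i) \<and>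
      F i / M = 1 / h * (w (i + 1) - w i) + \<gamma> * w i + g * (sin (\<alpha> i) + c)"
    if "i \<in> {1..<n}" for i
  proof -
    from assms(4) that have i: "0 < w i" "\<bar>F i\<bar> \<le> M * g * \<mu>" "F i * sqrt (w i) \<le> Pmax"
      "M / h * (w (i + 1) - w i) = - \<Gamma> * w i + F i - M * g * sin (\<alpha> i) - M * g * c"
      by (auto simp: feasible_P_def)
    have "F i = M * (1 / h * (w (i + 1) - w i) + \<gamma> * w i + g * (sin (\<alpha> i) + c))"
      using i(4) assms(1) unfolding assms(3) by (simp add: distrib_left)
    then have "F i / M = 1 / h * (w (i + 1) - w i) + \<gamma> * w i + g * (sin (\<alpha> i) + c)"
      using assms(1) by simp
    moreover have "\<bar>F i / M\<bar> \<le> g * \<mu>"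
      using i(2) assms(1) by (simp add: abs_divide pos_divide_le_eq mult.commute mult.left_commute)
    \<comment> \<open>Dividing the power bound by \<open>Pmax * sqrt (w i)\<close> gives the second
      lower bound on \<open>t\<close> at the tight choice \<open>1 / sqrt (w i)\<close>.\<close>
    moreover have "M * (F i / M) / Pmax \<le> 1 / sqrt (w i)"
      using i assms by (simp add: field_simps)
    ultimately show ?thesis by blast
  qed
  with assms(4) show ?thesis
    unfolding feasible_P_def feasible_R_def by blast
qed

text \<open>Scaling by \<open>M\<close> carries over the force bound and the dynamics. The power
  bound is the one constraint of (P) that (R) does not impose: (R) only bounds \<open>t\<close>
  below by both quantities, without comparing them.\<close>

lemma feasible_P_of_R:
  assumes "M > 0" "\<gamma> = \<Gamma> / M"
    and "feasible_R n h M g \<mu> c \<gamma> Pmax \<alpha> wmax winit w t f"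
    and "\<forall>i\<in>{1..<n}. M * f i * sqrt (w i) \<le> Pmax"
  shows "feasible_P n h M g \<mu> c \<Gamma> Pmax \<alpha> wmax winit w (\<lambda>i. M * f i)"
proof -
  have "\<bar>M * f i\<bar> \<le> M * g * \<mu> \<and>
      M / h * (w (i + 1) - w i) = - \<Gamma> * w i + M * f i - M * g * sin (\<alpha> i) - M * g * c"
    if "i \<in> {1..<n}" for i
  proof -
    from assms(3) that have i: "\<bar>f i\<bar> \<le> g * \<mu>"
      "f i = 1 / h * (w (i + 1) - w i) + \<gamma> * w i + g * (sin (\<alpha> i) + c)"
      unfolding feasible_R_def by blast+
    have "M * f i = M / h * (w (i + 1) - w i) + \<Gamma> * w i + M * (g * (sin (\<alpha> i) + c))"
      using assms(1) unfolding i(2) assms(2) by (simp add: distrib_left)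
    then have "M / h * (w (i + 1) - w i) = - \<Gamma> * w i + M * f i - M * g * sin (\<alpha> i) - M * g * c"
      by (simp add: algebra_simps)
    with i(1) assms(1) show ?thesis
      by (simp add: abs_mult)
  qed
  with assms(3,4) show ?thesis
    unfolding feasible_P_def feasible_R_def by blast
qed

lemma objective_P_eq_R:
  assumes "M > 0"
  shows "objective_P n h lam \<eta> w F = objective_R n h M lam \<eta> (\<lambda>i. 1 / sqrt (w i)) (\<lambda>i. F i / M)"
proof -
  have "M * max (\<eta> * (x / M)) (x / M) = max (\<eta> * x) x" for x
    using assms by (auto simp: max_def field_simps)
  then show ?thesis
    by (simp add: objective_P_def objective_R_def mult.assoc)
qed

text \<open>Lowering each \<open>t i\<close> to its bound \<open>1 / sqrt (w i)\<close> cannot raise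
  the cost.\<close>

lemma objective_P_le_R:
  assumes "M > 0" "h > 0" "feasible_R n h M g \<mu> c \<gamma> Pmax \<alpha> wmax winit w t f"
  shows "objective_P n h lam \<eta> w (\<lambda>i. M * f i) \<le> objective_R n h M lam \<eta> t f"
  using assms by (auto simp: objective_P_eq_R objective_R_def feasible_R_def intro!: sum_mono mult_left_mono)

lemma optimal_R_le:
  assumes "optimal_R n h M g \<mu> c \<gamma> Pmax lam \<eta> \<alpha> wmax winit w t f"
    and "feasible_R n h M g \<mu> c \<gamma> Pmax \<alpha> wmax winit w' t' f'"
  shows "objective_R n h M lam \<eta> t f \<le> objective_R n h M lam \<eta> t' f'"
  using assms unfolding optimal_R_def is_arg_min_def by (force simp: not_less)

text \<open>Compares costs after a perturbation at two neighbouring indices. If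
  \<open>i = n - 1\<close>, the index \<open>i + 1\<close> lies outside the sum and the decrease at
  \<open>i\<close> has to suffice, hence the separate condition at \<open>i\<close>.\<close>

lemma sum_less_if_changed_at_pair:
  fixes a b :: "nat \<Rightarrow> real"
  assumes "i \<in> {1..<n}"
    and "\<And>j. j \<noteq> i \<Longrightarrow> j \<noteq> i + 1 \<Longrightarrow> b j = a j"
    and "b i < a i"
    and "i + 1 < n \<Longrightarrow> b i + b (i + 1) < a i + a (i + 1)"
  shows "sum b {1..<n} < sum a {1..<n}"
proof (cases "i + 1 < n")
  case True
  have split: "sum d {1..<n} = sum d ({1..<n} - {i, i + 1}) + (d i + d (i + 1))" for d :: "nat \<Rightarrow> real"
    using assms(1) True by (subst sum.subset_diff[of "{i, i + 1}"]) auto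
  have "sum b ({1..<n} - {i, i + 1}) = sum a ({1..<n} - {i, i + 1})"
    using assms(2) by (intro sum.cong) auto
  then show ?thesis
    using assms(4)[OF True] unfolding split by linarith
next
  case False
  then have "b j \<le> a j" if "j \<in> {1..<n}" for j
    using assms that by (cases "j = i") auto
  then show ?thesis
    using assms by (intro sum_strict_mono_ex1) auto
qed

section \<open>The power bound at optimal solutions of (R)\<close>

lemma optimal_R_power_bound:
  fixes h M g \<mu> c \<gamma> Pmax lam \<eta> wbar winit :: real
  assumes pos: "h > 0" "M > 0" "g > 0" "c > 0" "\<gamma> > 0" "Pmax > 0"
    and lam: "lam \<ge> 0" and \<eta>: "\<eta> \<le> 1"
    and wbar: "wbar > 0" "Pmax / (M * sqrt wbar) = g * \<mu>"
    and step: "(1 - h * \<gamma>) * wbar - h * g * (1 + c)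
           > (Pmax * h / (2 * M * (lam * \<gamma> * Pmax * h + 1))) powr (2 / 3)"
    and profile: "\<forall>i\<in>{1..n}. Pmax / (M * sqrt (wmax i)) \<ge> \<gamma> * wmax i + g * (sin (\<alpha> i) + c)"
    and opt: "optimal_R n h M g \<mu> c \<gamma> Pmax lam \<eta> \<alpha> wmax winit w t f"
  shows "\<forall>i\<in>{1..<n}. M * f i * sqrt (w i) \<le> Pmax"
proof (rule ccontr)
  assume not_bounded: "\<not> ?thesis"
  define V where "V = {i \<in> {1..<n}. M * f i * sqrt (w i) > Pmax}"
  define i where "i = Max V"
  have fin: "finite V" and "V \<noteq> {}"
    using not_bounded by (auto simp: V_def not_le)
  then have "i \<in> V"
    unfolding i_def by (rule Max_in)
  then have i: "i \<in> {1..<n}" and viol: "M * f i * sqrt (w i) > Pmax"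
    by (auto simp: V_def)
  have last: "M * f (i + 1) * sqrt (w (i + 1)) \<le> Pmax" if "i + 1 < n"
    using that Max_ge[OF fin, of "i + 1"] i unfolding i_def[symmetric] by (auto simp: V_def intro: leI)
  have feas: "feasible_R n h M g \<mu> c \<gamma> Pmax \<alpha> wmax winit w t f"
    using opt by (simp add: optimal_R_def is_arg_min_def)
  then have bounds: "\<And>j. j \<in> {1..n} \<Longrightarrow> 0 \<le> w j \<and> w j \<le> wmax j" and init: "w 1 = winit"
    and R: "\<And>j. j \<in> {1..<n} \<Longrightarrow> 0 < w j \<and> \<bar>f j\<bar> \<le> g * \<mu> \<and> t j \<ge> 1 / sqrt (w j) \<and> t j \<ge> M * f j / Pmax \<and>
        f j = 1 / h * (w (j + 1) - w j) + \<gamma> * w j + g * (sin (\<alpha> j) + c)"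
    unfolding feasible_R_def by blast+
  from R[OF i] have Ri: "0 < w i" "\<bar>f i\<bar> \<le> g * \<mu>" "t i \<ge> M * f i / Pmax"
      "f i = 1 / h * (w (i + 1) - w i) + \<gamma> * w i + g * (sin (\<alpha> i) + c)"
    by blast+

  have fi: "Pmax / (M * sqrt (w i)) < f i"
    using viol Ri(1) pos by (simp add: field_simps)
  \<comment> \<open>The full-power force per unit mass decreases with speed and equals the limit
    \<open>g * \<mu>\<close> at \<open>wbar\<close>.\<close>
  have "Pmax / (M * sqrt (w i)) < Pmax / (M * sqrt wbar)"
    using fi Ri(2) wbar(2) by linarith
  then have wbar_less: "wbar < w i"
    using pos wbar(1) Ri(1) by (simp add: field_simps)
  \<comment> \<open>The profile condition passes from \<open>wmax i\<close> down to
    \<open>w i\<close>, since its left side decreases and its right side increases with speed. Thus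
    \<open>f i\<close> exceeds the resistance at \<open>w i\<close>.\<close>
  have w_less: "w i < w (i + 1)"
  proof -
    have "w i \<le> wmax i"
      using bounds i by auto
    then have "Pmax / (M * sqrt (wmax i)) \<le> Pmax / (M * sqrt (w i))"
      using Ri(1) pos by (intro divide_left_mono mult_left_mono) auto
    moreover have "\<gamma> * w i \<le> \<gamma> * wmax i"
      using \<open>w i \<le> wmax i\<close> pos by simp
    moreover have "\<gamma> * wmax i + g * (sin (\<alpha> i) + c) \<le> Pmax / (M * sqrt (wmax i))"
      using profile i by auto
    ultimately have "0 < 1 / h * (w (i + 1) - w i)"
      using fi Ri(4) by linarith
    then show ?thesis
      using pos by (simp add: zero_less_divide_iff)
  qed
  have f_next: "f (i + 1) < g * \<mu>" if "i + 1 < n"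
  proof -
    have "f (i + 1) \<le> Pmax / (M * sqrt (w (i + 1)))"
      using last[OF that] pos wbar_less w_less wbar(1) by (simp add: field_simps)
    also have "\<dots> < Pmax / (M * sqrt wbar)"
      using pos wbar_less w_less wbar(1) by (intro divide_strict_left_mono) auto
    finally show ?thesis
      using wbar(2) by simp
  qed

  \<comment> \<open>Consequences of the step size condition\<close>
  have "0 \<le> h * g * (1 + c)"
    using pos by simp
  have "0 \<le> (Pmax * h / (2 * M * (lam * \<gamma> * Pmax * h + 1))) powr (2 / 3)"
    by simp
  then have "0 < (1 - h * \<gamma>) * wbar"
    using step \<open>0 \<le> h * g * (1 + c)\<close> by linarith
  then have h\<gamma>: "0 < 1 / h - \<gamma>"
    using wbar(1) pos by (simp add: zero_less_mult_iff field_simps)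
  have gt0: "0 < lam * \<gamma> * Pmax * h + 1"
    using pos lam by (simp add: add_nonneg_pos)
  have "(1 - h * \<gamma>) * wbar \<le> wbar"
    using pos wbar(1) by (simp add: algebra_simps)
  then have "(Pmax * h / (2 * M * (lam * \<gamma> * Pmax * h + 1))) powr (2 / 3) < wbar"
    using step \<open>0 \<le> h * g * (1 + c)\<close> by linarith
  then have "Pmax * h / (2 * M * (lam * \<gamma> * Pmax * h + 1)) < wbar * sqrt wbar"
    using pos gt0 wbar(1)
    by (intro less_mult_sqrt_if_powr_less) auto
  then have "Pmax * h < wbar * sqrt wbar * (2 * M * (lam * \<gamma> * Pmax * h + 1))"
    using pos gt0 by (subst (asm) pos_divide_less_eq) auto
  then have "1 / (2 * (wbar * sqrt wbar)) < M * (lam * \<gamma> * Pmax * h + 1) / (h * Pmax)"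
    using pos wbar(1) by (simp add: divide_simps) (simp add: algebra_simps)
  \<comment> \<open>This is the gain per unit of \<open>\<delta>\<close>: the drop of
    \<open>t i\<close>, plus the net drop of the force cost, in which the \<open>1 / h\<close> parts
    at \<open>i\<close> and \<open>i + 1\<close> cancel.\<close>
  also have "\<dots> = M / (h * Pmax) + lam * M * \<gamma>"
    using pos by (simp add: field_simps)
  finally have slope: "1 / (2 * (wbar * sqrt wbar)) < M / (h * Pmax) + lam * M * \<gamma>" .
  \<comment> \<open>A rate of increase of \<open>t (i + 1)\<close> that keeps both of its lower
    bounds satisfied.\<close>
  define D where "D = max (1 / (2 * (wbar * sqrt wbar))) (M * (1 / h - \<gamma>) / Pmax)"
  have "M * (1 / h - \<gamma>) / Pmax < M / (h * Pmax)"
    using pos by (simp add: field_simps)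
  moreover have "0 \<le> lam * M * \<gamma>"
    using pos lam by simp
  ultimately have D: "D < M / (h * Pmax) + lam * M * \<gamma>"
    using slope by (simp add: D_def)

  \<comment> \<open>The three terms keep \<open>w (i + 1) - \<delta>\<close> at least
    \<open>w i\<close>, keep \<open>M * f i / Pmax\<close> at least \<open>1 / sqrt (w i)\<close>
    after the change, and keep the new \<open>f (i + 1)\<close> within \<open>g * \<mu>\<close>. The
    value 1 is a placeholder for \<open>i + 1 = n\<close>, where no such force bound exists.\<close>
  define \<delta> where "\<delta> = Min {w (i + 1) - w i, h * (f i - Pmax / (M * sqrt (w i))),
      if i + 1 < n then (g * \<mu> - f (i + 1)) / (1 / h - \<gamma>) else 1}"
  have \<delta>: "0 < \<delta>"
    using w_less fi pos h\<gamma> f_next by (simp add: \<delta>_def)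
  have "\<delta> \<le> w (i + 1) - w i"
    by (simp add: \<delta>_def)
  have "\<delta> \<le> h * (f i - Pmax / (M * sqrt (w i)))"
    by (simp add: \<delta>_def)
  then have \<delta>i: "Pmax / (M * sqrt (w i)) \<le> f i - \<delta> / h"
    using pos by (simp add: field_simps)
  have \<delta>next: "f (i + 1) + \<delta> * (1 / h - \<gamma>) \<le> g * \<mu>" if "i + 1 < n"
  proof -
    have "\<delta> \<le> (g * \<mu> - f (i + 1)) / (1 / h - \<gamma>)"
      using that by (simp add: \<delta>_def)
    then show ?thesis
      using h\<gamma> by (simp add: pos_le_divide_eq)
  qed

  \<comment> \<open>The perturbed point and its feasibility\<close>
  define w' where "w' = w(i + 1 := w (i + 1) - \<delta>)"
  \<comment> \<open>The dynamics force these values. For \<open>i + 1 = n\<close>, the entries of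
    \<open>f'\<close> and \<open>t'\<close> at \<open>n\<close> are never inspected.\<close>
  define f' where "f' = f(i := f i - \<delta> / h, i + 1 := f (i + 1) + \<delta> * (1 / h - \<gamma>))"
  define t' where "t' = t(i := t i - \<delta> * M / (h * Pmax), i + 1 := t (i + 1) + \<delta> * D)"
  \<comment> \<open>With the force at \<open>i\<close> nonnegative before and after, its cost has
    slope exactly 1, so the reduction counts in full.\<close>
  have f'i_pos: "0 \<le> f i - \<delta> / h"
    using \<delta>i pos Ri(1) by (smt (verit) divide_nonneg_pos mult_pos_pos real_sqrt_gt_zero)
  have "feasible_R n h M g \<mu> c \<gamma> Pmax \<alpha> wmax winit w' t' f'"
    unfolding feasible_R_def
  proof (intro conjI ballI)
    fix j assume "j \<in> {1..n}"
    then show "0 \<le> w' j" "w' j \<le> wmax j"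
      using bounds[of j] \<delta> \<open>\<delta> \<le> w (i + 1) - w i\<close> Ri(1) by (auto simp: w'_def)
  next
    show "w' 1 = winit"
      using i init by (simp add: w'_def)
  next
    fix j assume j: "j \<in> {1..<n}"
    consider "j = i" | "j = i + 1" | "j \<noteq> i" "j \<noteq> i + 1" by blast
    then have "0 < w' j \<and> \<bar>f' j\<bar> \<le> g * \<mu> \<and> 1 / sqrt (w' j) \<le> t' j \<and> M * f' j / Pmax \<le> t' j \<and>
      f' j = 1 / h * (w' (j + 1) - w' j) + \<gamma> * w' j + g * (sin (\<alpha> j) + c)"
    proof cases
      case 1
      have "M * (f i - \<delta> / h) / Pmax \<le> t i - \<delta> * M / (h * Pmax)"
        using Ri(3) pos by (simp add: field_simps)
      moreover have "1 / sqrt (w i) \<le> M * (f i - \<delta> / h) / Pmax"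
      proof -
        have "1 / sqrt (w i) = M * (Pmax / (M * sqrt (w i))) / Pmax"
          using pos by simp
        also have "\<dots> \<le> M * (f i - \<delta> / h) / Pmax"
          using \<delta>i pos by (intro divide_right_mono mult_left_mono) auto
        finally show ?thesis .
      qed
      moreover have "f i - \<delta> / h = 1 / h * (w (i + 1) - \<delta> - w i) + \<gamma> * w i + g * (sin (\<alpha> i) + c)"
        using Ri(4) by (simp add: diff_divide_distrib)
      moreover have "\<bar>f i - \<delta> / h\<bar> \<le> g * \<mu>"
      proof -
        have "0 < \<delta> / h" using \<delta> pos by simp
        then show ?thesis using f'i_pos Ri(2) by linarith
      qed
      ultimately show ?thesis
        using 1 Ri(1) by (simp add: w'_def f'_def t'_def)
    next
      case 2
      then have n: "i + 1 < n" using j by simp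
      from R[OF j] have Rn: "\<bar>f (i + 1)\<bar> \<le> g * \<mu>" "t (i + 1) \<ge> 1 / sqrt (w (i + 1))"
        "t (i + 1) \<ge> M * f (i + 1) / Pmax"
        "f (i + 1) = 1 / h * (w (i + 1 + 1) - w (i + 1)) + \<gamma> * w (i + 1) + g * (sin (\<alpha> (i + 1)) + c)"
        unfolding 2 by blast+
      have v: "wbar \<le> w (i + 1) - \<delta>"
        using \<open>\<delta> \<le> w (i + 1) - w i\<close> wbar_less by linarith
      \<comment> \<open>The lowered speed stays above \<open>wbar\<close>, so the slope bound can be
        taken at \<open>wbar\<close>, where the step size condition controls it.\<close>
      have "1 / sqrt (w (i + 1) - \<delta>) - 1 / sqrt (w (i + 1)) \<le> \<delta> / (2 * (wbar * sqrt wbar))"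
        using inverse_sqrt_diff_le[OF wbar(1) v, of "w (i + 1)"] \<delta> by simp
      also have "\<dots> = \<delta> * (1 / (2 * (wbar * sqrt wbar)))"
        by simp
      also have "\<dots> \<le> \<delta> * D"
        using \<delta> by (intro mult_left_mono) (auto simp: D_def)
      finally have "1 / sqrt (w (i + 1) - \<delta>) \<le> t (i + 1) + \<delta> * D"
        using Rn(2) by linarith
      moreover have "M * (f (i + 1) + \<delta> * (1 / h - \<gamma>)) / Pmax \<le> t (i + 1) + \<delta> * D"
      proof -
        have "M * (f (i + 1) + \<delta> * (1 / h - \<gamma>)) / Pmax
            = M * f (i + 1) / Pmax + \<delta> * (M * (1 / h - \<gamma>) / Pmax)"
          by (simp add: distrib_left add_divide_distrib mult.left_commute)
        also have "\<delta> * (M * (1 / h - \<gamma>) / Pmax) \<le> \<delta> * D"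
          using \<delta> by (intro mult_left_mono) (auto simp: D_def)
        finally show ?thesis
          using Rn(3) by linarith
      qed
      moreover have "\<bar>f (i + 1) + \<delta> * (1 / h - \<gamma>)\<bar> \<le> g * \<mu>"
      proof -
        have "0 < \<delta> * (1 / h - \<gamma>)" using \<delta> h\<gamma> by simp
        then show ?thesis using Rn(1) \<delta>next[OF n] by linarith
      qed
      moreover have "f (i + 1) + \<delta> * (1 / h - \<gamma>) = 1 / h * (w (i + 1 + 1) - (w (i + 1) - \<delta>)) +
          \<gamma> * (w (i + 1) - \<delta>) + g * (sin (\<alpha> (i + 1)) + c)"
        by (subst Rn(4)) (simp add: algebra_simps diff_divide_distrib add_divide_distrib)
      moreover have "0 < w (i + 1) - \<delta>"
        using v wbar(1) by linarith
      ultimately show ?thesis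
        using 2 by (simp add: w'_def f'_def t'_def)
    next
      case 3
      then have "w' j = w j" "w' (j + 1) = w (j + 1)" "f' j = f j" "t' j = t j"
        by (simp_all add: w'_def f'_def t'_def)
      then show ?thesis
        using R[OF j] by metis
    qed
    then show "0 < w' j" "\<bar>f' j\<bar> \<le> g * \<mu>" "1 / sqrt (w' j) \<le> t' j" "M * f' j / Pmax \<le> t' j"
      "f' j = 1 / h * (w' (j + 1) - w' j) + \<gamma> * w' j + g * (sin (\<alpha> j) + c)"
      by blast+
  qed

  \<comment> \<open>Strict decrease of the objective\<close>
  from optimal_R_le[OF opt this]
  have "objective_R n h M lam \<eta> t f \<le> objective_R n h M lam \<eta> t' f'" .
  moreover have "objective_R n h M lam \<eta> t' f' < objective_R n h M lam \<eta> t f"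
    unfolding objective_R_def sum_distrib_left[symmetric]
  proof (intro mult_strict_left_mono sum_less_if_changed_at_pair[OF i] \<open>h > 0\<close>)
    have "0 < \<delta> / h" "0 < \<delta> * M / (h * Pmax)"
      using \<delta> pos by simp_all
    have "max (\<eta> * f' i) (f' i) = f' i" "max (\<eta> * f i) (f i) = f i"
      using f'i_pos \<open>0 < \<delta> / h\<close> by (intro max_scaled_pos[OF \<eta>]; simp add: f'_def)+
    then have di: "lam * M * max (\<eta> * f' i) (f' i) + t' i =
        lam * M * max (\<eta> * f i) (f i) + t i - lam * M * (\<delta> / h) - \<delta> * M / (h * Pmax)"
      by (simp add: f'_def t'_def right_diff_distrib)
    moreover have "0 \<le> lam * M * (\<delta> / h)"
      using pos lam \<delta> by simp
    ultimately show "lam * M * max (\<eta> * f' i) (f' i) + t' i < lam * M * max (\<eta> * f i) (f i) + t i"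
      using \<open>0 < \<delta> * M / (h * Pmax)\<close> by linarith
    let ?k = "i + 1"
    \<comment> \<open>The force at \<open>i + 1\<close> may have either sign, so only an upper bound
      on its extra cost is available.\<close>
    have "max (\<eta> * f' ?k) (f' ?k) - max (\<eta> * f ?k) (f ?k) \<le> f' ?k - f ?k"
      using \<delta> h\<gamma> by (intro max_scaled_diff_le[OF \<eta>]) (simp add: f'_def)
    then have "lam * M * (max (\<eta> * f' ?k) (f' ?k) - max (\<eta> * f ?k) (f ?k)) \<le> lam * M * (\<delta> * (1 / h - \<gamma>))"
      using lam pos by (intro mult_left_mono) (simp_all add: f'_def)
    moreover have "\<delta> * D < \<delta> * (M / (h * Pmax) + lam * M * \<gamma>)"
      using D \<delta> by (rule mult_strict_left_mono)
    moreover have "lam * M * (\<delta> * (1 / h - \<gamma>)) = lam * M * (\<delta> / h) - \<delta> * (lam * M * \<gamma>)"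
      by (simp add: algebra_simps)
    ultimately show "lam * M * max (\<eta> * f' i) (f' i) + t' i + (lam * M * max (\<eta> * f' ?k) (f' ?k) + t' ?k)
        < lam * M * max (\<eta> * f i) (f i) + t i + (lam * M * max (\<eta> * f ?k) (f ?k) + t ?k)"
      unfolding di by (simp add: t'_def algebra_simps)
  qed (simp add: f'_def t'_def)
  ultimately show False
    by linarith
qed

theorem proposition3p6:
  fixes n :: nat
    and h M g \<mu> c \<Gamma> Pmax lam \<eta> \<gamma> wbar winit :: real
    and \<alpha> wmax :: "nat \<Rightarrow> real"
    and w t f :: "nat \<Rightarrow> real"
  assumes "n \<ge> 2"
    and "h > 0" "M > 0" "g > 0" "\<mu> > 0" "c > 0" "\<Gamma> > 0" "Pmax > 0"
    and "lam \<ge> 0" "0 \<le> \<eta>" "\<eta> \<le> 1"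
    and "\<forall>i\<in>{1..n}. wmax i > 0"
    and "winit \<ge> 0"
    and "\<gamma> = \<Gamma> / M"
    and "wbar > 0" "Pmax / (M * sqrt wbar) = g * \<mu>"
    and "(1 - h * \<gamma>) * wbar - h * g * (1 + c)
           > (Pmax * h / (2 * M * (lam * \<gamma> * Pmax * h + 1))) powr (2 / 3)"
    and "\<forall>i\<in>{1..n}. Pmax / (M * sqrt (wmax i)) \<ge> \<gamma> * wmax i + g * (sin (\<alpha> i) + c)"
    and "optimal_R n h M g \<mu> c \<gamma> Pmax lam \<eta> \<alpha> wmax winit w t f"
  shows "feasible_P n h M g \<mu> c \<Gamma> Pmax \<alpha> wmax winit w (\<lambda>i. M * f i) \<and>
         optimal_P n h M g \<mu> c \<Gamma> Pmax lam \<eta> \<alpha> wmax winit w (\<lambda>i. M * f i)"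
proof -
  have power: "\<forall>i\<in>{1..<n}. M * f i * sqrt (w i) \<le> Pmax"
    using assms by (intro optimal_R_power_bound[where \<gamma> = \<gamma> and wbar = wbar]) auto
  have R: "feasible_R n h M g \<mu> c \<gamma> Pmax \<alpha> wmax winit w t f"
    using assms(19) by (simp add: optimal_R_def is_arg_min_def)
  have P: "feasible_P n h M g \<mu> c \<Gamma> Pmax \<alpha> wmax winit w (\<lambda>i. M * f i)"
    using feasible_P_of_R[OF _ _ R power] assms by blast
  \<comment> \<open>Sandwich: the cost in (P) is at most the optimal value of (R), which is at most
    the cost of the lift of any competitor, and lifting preserves cost.\<close>
  have "objective_P n h lam \<eta> w (\<lambda>i. M * f i) \<le> objective_P n h lam \<eta> w' F'"
    if "feasible_P n h M g \<mu> c \<Gamma> Pmax \<alpha> wmax winit w' F'" for w' F'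
  proof -
    have "objective_P n h lam \<eta> w (\<lambda>i. M * f i) \<le> objective_R n h M lam \<eta> t f"
      using objective_P_le_R[OF _ _ R] assms by blast
    also have "\<dots> \<le> objective_R n h M lam \<eta> (\<lambda>i. 1 / sqrt (w' i)) (\<lambda>i. F' i / M)"
      using optimal_R_le[OF assms(19)] feasible_R_of_P[OF _ _ _ that] assms by blast
    also have "\<dots> = objective_P n h lam \<eta> w' F'"
      using objective_P_eq_R[OF \<open>M > 0\<close>] by simp
    finally show ?thesis .
  qed
  with P show ?thesis
    by (auto simp: optimal_P_def is_arg_min_def not_less)
qed

end
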